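(* Let $(X,d)$ be a metric space and let $g:X\to X$. Assume that there exist $k\in(0,1)$ and a metric-preserving function $f:[0,\infty)\to[0,\infty)$ satisfying the following conditions: (a) for each $x\in X$ there exists $\varepsilon>0$ such that for every $u\in X$, $d(x,u)<\varepsilon$ implies $f(d(g(x),g(u)))\le k\,d(x,u)$; (b) $f'(0)>k$. Then $g$ is a local radial contraction on $(X,d)$.
   Context: A function $f:[0,\infty)\to[0,\infty)$ is metric-preserving if for every metric space $(Y,\rho)$, the composition $f\circ\rho$ is a metric on $Y$. For a metric-preserving $f$, $f'(0)$ denotes the one-sided derivative $\lim_{y\to0^+}\frac{f(y)-f(0)}{y}=\lim_{y\to0^+}\frac{f(y)}{y}$ (note $f(0)=0$); it is a known fact that this limit always exists in $\mathbb R\cup\{+\infty\}$, and the value $+\infty$ is allowed. A map $g:X\to X$ on a metric space $(X,d)$ is a local radial contraction if there exists $c\in(0,1)$ such that for each $x\in X$ there exists $\varepsilon>0$ such that for every $u\in X$, $d(x,u)<\varepsilon$ implies $d(g(x),g(u))\le c\,d(x,u)$. *)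

theory Defs
  imports "HOL-Analysis.Analysis"
begin

text \<open>
  A formula of HOL cannot quantify over all types, so the metric spaces in the definition below are
  those whose points are real numbers (the set \<open>Y\<close> and the metric \<open>\<rho>\<close> on it being arbitrary). This
  loses nothing: \<open>metric_preserving_any_type\<close> shows that such an \<open>f\<close> preserves the metrics
  on sets over every type. The values of \<open>f\<close> at negative arguments are irrelevant.
\<close>

definition metric_preserving :: "(real \<Rightarrow> real) \<Rightarrow> bool" where
  "metric_preserving f \<longleftrightarrow>
     (\<forall>t\<ge>0. 0 \<le> f t) \<and>
     (\<forall>(Y :: real set) \<rho>. Metric_space Y \<rho> \<longrightarrow> Metric_space Y (\<lambda>x y. f (\<rho> x y)))"

lemma metric_preserving_any_type:
  fixes Y :: "'a set"
  assumes f: "metric_preserving f" and Y: "Metric_space Y \<rho>"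
  shows "Metric_space Y (\<lambda>x y. f (\<rho> x y))"
proof -
  interpret Y: Metric_space Y \<rho> by (rule Y)
  have *: "Metric_space S (\<lambda>x y. f (\<rho> x y))" if S: "finite S" "S \<subseteq> Y" for S
  proof -
    obtain h :: "'a \<Rightarrow> nat" where "inj_on h S"
      using finite_imp_inj_to_nat_seg[OF S(1)] by blast
    then have h: "inj_on (\<lambda>x. real (h x)) S"
      by (auto simp: inj_on_def)
    define k where "k = inv_into S (\<lambda>x. real (h x))"
    have k: "k (real (h x)) = x" if "x \<in> S" for x
      unfolding k_def using inv_into_f_f[OF h that] .
    have "Metric_space ((\<lambda>x. real (h x)) ` S) (\<lambda>x y. \<rho> (k x) (k y))"
    proof
      fix r s assume "r \<in> (\<lambda>x. real (h x)) ` S" "s \<in> (\<lambda>x. real (h x)) ` S"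
      then obtain x y where "x \<in> S" "y \<in> S" "r = real (h x)" "s = real (h y)"
        by blast
      then show "\<rho> (k r) (k s) = 0 \<longleftrightarrow> r = s"
        using S(2) inj_on_eq_iff[OF h, of x y] Y.zero[of x y] by (metis k subsetD)
    next
      fix r s t
      assume "r \<in> (\<lambda>x. real (h x)) ` S" "s \<in> (\<lambda>x. real (h x)) ` S" "t \<in> (\<lambda>x. real (h x)) ` S"
      then have "k r \<in> Y" "k s \<in> Y" "k t \<in> Y"
        using S(2) k by auto
      then show "\<rho> (k r) (k t) \<le> \<rho> (k r) (k s) + \<rho> (k s) (k t)"
        by (rule Y.triangle)
    qed (simp_all add: Y.commute)
    then have "Metric_space ((\<lambda>x. real (h x)) ` S) (\<lambda>x y. f (\<rho> (k x) (k y)))"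
      using f by (auto simp: metric_preserving_def)
    then interpret Z: Metric_space "(\<lambda>x. real (h x)) ` S" "\<lambda>x y. f (\<rho> (k x) (k y))" .
    show ?thesis
    proof
      show "0 \<le> f (\<rho> x y)" for x y
        using f by (simp add: metric_preserving_def)
      show "f (\<rho> x y) = f (\<rho> y x)" for x y
        by (simp add: Y.commute)
      show "f (\<rho> x y) = 0 \<longleftrightarrow> x = y" if "x \<in> S" "y \<in> S" for x y
        using Z.zero[of "real (h x)" "real (h y)"] that h by (simp add: k) (auto simp: inj_on_def)
      show "f (\<rho> x z) \<le> f (\<rho> x y) + f (\<rho> y z)" if "x \<in> S" "y \<in> S" "z \<in> S" for x y z
        using Z.triangle[of "real (h x)" "real (h y)" "real (h z)"] that by (simp add: k)
    qed
  qed
  show ?thesis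
  proof
    show "0 \<le> f (\<rho> x y)" for x y
      using f by (simp add: metric_preserving_def)
    show "f (\<rho> x y) = f (\<rho> y x)" for x y
      by (simp add: Y.commute)
    show "f (\<rho> x y) = 0 \<longleftrightarrow> x = y" if "x \<in> Y" "y \<in> Y" for x y
      using Metric_space.zero[OF *[of "{x, y}"], of x y] that by simp
    show "f (\<rho> x z) \<le> f (\<rho> x y) + f (\<rho> y z)" if "x \<in> Y" "y \<in> Y" "z \<in> Y" for x y z
      using Metric_space.triangle[OF *[of "{x, y, z}"], of x y z] that by simp
  qed
qed

text \<open>
  \<open>Lim\<close> is a description operator, meaningful only where the limit exists;
  \<open>metric_preserving_right_deriv\<close> shows that it does exist, possibly as \<open>\<infinity>\<close>, for every
  metric-preserving function.
\<close>

definition right_deriv_at_0 :: "(real \<Rightarrow> real) \<Rightarrow> ereal" where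
  "right_deriv_at_0 f = Lim (at_right 0) (\<lambda>y. ereal ((f y - f 0) / y))"

lemma metric_preserving_right_deriv:
  assumes f: "metric_preserving f"
  shows "((\<lambda>y. ereal ((f y - f 0) / y)) \<longlongrightarrow> right_deriv_at_0 f) (at_right 0)"
proof -
  interpret R: Metric_space "UNIV :: real set" "\<lambda>x y. f (dist x y)"
    using metric_preserving_any_type[OF f Met_TC.Metric_space_axioms] .
  interpret C: Metric_space "UNIV :: complex set" "\<lambda>x y. f (dist x y)"
    using metric_preserving_any_type[OF f Met_TC.Metric_space_axioms] .
  have f0: "f 0 = 0"
    using R.zero[of 0 0] by simp
  have f_nonneg: "f t \<ge> 0" if "t \<ge> 0" for t
    using f that by (simp add: metric_preserving_def)
  have subadd: "f (a + b) \<le> f a + f b" if "a \<ge> 0" "b \<ge> 0" for a b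
    using R.triangle[of 0 a "a + b"] that by (simp add: dist_real_def add.commute)
  have double: "f a \<le> 2 * f b" if "0 \<le> a" "a \<le> 2 * b" for a b
  proof -
    have "(a / 2)\<^sup>2 \<le> b\<^sup>2"
      using that by (intro power_mono) auto
    then have "dist (Complex 0 0) (Complex (a / 2) (sqrt (b\<^sup>2 - (a / 2)\<^sup>2))) = b"
      "dist (Complex (a / 2) (sqrt (b\<^sup>2 - (a / 2)\<^sup>2))) (Complex a 0) = b"
      "dist (Complex 0 0) (Complex a 0) = a"
      using that by (auto simp: dist_norm cmod_def power2_eq_square)
    then show ?thesis
      using C.triangle[of "Complex 0 0" "Complex (a / 2) (sqrt (b\<^sup>2 - (a / 2)\<^sup>2))" "Complex a 0"]
      by simp
  qed
  have mult: "f (real n * b) \<le> real n * f b" if "b \<ge> 0" for n b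
  proof (induction n)
    case (Suc n)
    then show ?case
      using subadd[of b "real n * b"] that by (simp add: algebra_simps)
  qed (simp add: f0)
  have key: "f a / (a + b) \<le> f b / b" if "0 < b" "b \<le> a" for a b
  proof -
    define n where "n = nat \<lfloor>a / b\<rfloor>"
    have "real n = of_int \<lfloor>a / b\<rfloor>" and q: "a / b \<ge> 1"
      using that by (auto simp: n_def)
    then have n: "real n \<le> a / b" "a / b < real n + 1"
      by linarith+
    then have "n \<ge> 1"
      using q by linarith
    then obtain m where m: "n = Suc m"
      by (cases n) auto
    have n': "real n * b \<le> a" "a < (real n + 1) * b"
      using n that by (simp_all add: field_simps)
    then have "f (a - real m * b) \<le> 2 * f b"
      using that by (intro double) (auto simp: m algebra_simps)
    moreover have "f a \<le> f (real m * b) + f (a - real m * b)"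
      using subadd[of "real m * b" "a - real m * b"] n' that by (simp add: m algebra_simps)
    ultimately have "f a \<le> (real n + 1) * f b"
      using mult[of b m] that by (simp add: m algebra_simps)
    then have "f a * b \<le> ((real n + 1) * b) * f b"
      using that by (simp add: mult.commute mult.left_commute)
    also have "\<dots> \<le> (a + b) * f b"
      using n' that f_nonneg[of b] by (intro mult_right_mono) (auto simp: algebra_simps)
    finally show ?thesis
      using that by (simp add: field_simps)
  qed
  define s where "s = (SUP y\<in>{0<..}. ereal (f y / y))"
  have "((\<lambda>y. ereal (f y / y)) \<longlongrightarrow> s) (at_right 0)"
  proof (rule order_tendstoI)
    fix c assume "c < s"
    then obtain a where a: "a > 0" "c < ereal (f a / a)"
      unfolding s_def less_SUP_iff by auto
    have "((\<lambda>b. ereal (f a / (a + b))) \<longlongrightarrow> ereal (f a / (a + 0))) (at_right 0)"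
      using a by (intro tendsto_intros) auto
    then have "\<forall>\<^sub>F b in at_right 0. c < ereal (f a / (a + b))"
      using a by (intro order_tendstoD) auto
    moreover have "\<forall>\<^sub>F b in at_right 0. b \<in> {0<..<a}"
      using a by (intro eventually_at_right_real)
    ultimately show "\<forall>\<^sub>F b in at_right 0. c < ereal (f b / b)"
    proof eventually_elim
      case (elim b)
      then have "ereal (f a / (a + b)) \<le> ereal (f b / b)"
        using key[of b a] by simp
      then show ?case
        using elim by (meson less_le_trans)
    qed
  next
    fix c assume "s < c"
    have "ereal (f b / b) \<le> s" if "b > 0" for b
      unfolding s_def using that by (intro SUP_upper) auto
    with \<open>s < c\<close> show "\<forall>\<^sub>F b in at_right 0. ereal (f b / b) < c"
      by (auto simp: eventually_at_filter intro!: always_eventually intro: le_less_trans)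
  qed
  then show ?thesis
    unfolding right_deriv_at_0_def by (simp add: f0 tendsto_Lim)
qed

definition local_radial_contraction :: "'a set \<Rightarrow> ('a \<Rightarrow> 'a \<Rightarrow> real) \<Rightarrow> ('a \<Rightarrow> 'a) \<Rightarrow> bool" where
  "local_radial_contraction X d g \<longleftrightarrow>
     g \<in> X \<rightarrow> X \<and>
     (\<exists>c. 0 < c \<and> c < 1 \<and>
       (\<forall>x\<in>X. \<exists>\<epsilon>>0. \<forall>u\<in>X. d x u < \<epsilon> \<longrightarrow> d (g x) (g u) \<le> c * d x u))"

end

theory Submission
  imports Defs
begin

text \<open>
  Pick \<open>l\<close> with \<open>k < l < f'(0)\<close>, so that \<open>l y \<le> f y\<close> for \<open>y\<close> below some \<open>\<delta>\<close>. Since \<open>f\<close> preserves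
  isosceles triangles, it is bounded away from \<open>0\<close> on \<open>[\<delta>, \<infinity>)\<close>; hence (a) forces
  \<open>d (g x) (g u) < \<delta>\<close> for \<open>u\<close> near \<open>x\<close>, and then \<open>l d (g x) (g u) \<le> f (d (g x) (g u)) \<le> k d x u\<close>.
  The contraction constant is \<open>k / l\<close>.
\<close>

lemma metric_preserving_0:
  assumes "metric_preserving f"
  shows "f 0 = 0"
  using Metric_space.zero[OF metric_preserving_any_type[OF assms Met_TC.Metric_space_axioms], of "0::real" 0]
  by simp

lemma metric_preserving_pos:
  assumes "metric_preserving f" "t > 0"
  shows "f t > 0"
proof -
  interpret Metric_space "UNIV :: real set" "\<lambda>x y. f (dist x y)"
    using metric_preserving_any_type[OF assms(1) Met_TC.Metric_space_axioms] .
  show ?thesis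
    using mdist_pos_less[of 0 t] assms(2) by simp
qed

text \<open>Let 0 have distance \<open>b\<close> to all other reals and let any two of these have
  distance \<open>a\<close>; as \<open>a \<le> 2 * b\<close>, this is a metric. Its triangle 1, 0, 2
  has legs \<open>b\<close> and base \<open>a\<close>, and \<open>f\<close> must respect it.\<close>

lemma metric_preserving_double:
  assumes f: "metric_preserving f" and "0 < a" "a \<le> 2 * b"
  shows "f a \<le> 2 * f b"
proof -
  define \<rho> where "\<rho> x y = (if x = y then 0 else if x = 0 \<or> y = 0 then b else a)" for x y :: real
  have "Metric_space UNIV \<rho>"
    using assms(2,3) by unfold_locales (auto simp: \<rho>_def)
  then have "Metric_space UNIV (\<lambda>x y. f (\<rho> x y))"
    using f by (simp add: metric_preserving_def)
  from Metric_space.triangle[OF this, of 1 0 2] show ?thesis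
    by (simp add: \<rho>_def)
qed

theorem theorem16:
  fixes X :: "'a set" and d :: "'a \<Rightarrow> 'a \<Rightarrow> real" and g :: "'a \<Rightarrow> 'a"
  assumes "Metric_space X d"
    and "g \<in> X \<rightarrow> X"
    and "\<exists>k f. 0 < k \<and> k < 1 \<and> metric_preserving f \<and>
           (\<forall>x\<in>X. \<exists>\<epsilon>>0. \<forall>u\<in>X. d x u < \<epsilon> \<longrightarrow> f (d (g x) (g u)) \<le> k * d x u) \<and>
           ereal k < right_deriv_at_0 f"
  shows "local_radial_contraction X d g"
proof -
  interpret Metric_space X d by (rule assms(1))
  obtain k f where k: "0 < k" and f: "metric_preserving f"
    and contr: "\<And>x. x \<in> X \<Longrightarrow> \<exists>\<epsilon>>0. \<forall>u\<in>X. d x u < \<epsilon> \<longrightarrow> f (d (g x) (g u)) \<le> k * d x u"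
    and deriv: "ereal k < right_deriv_at_0 f"
    using assms(3) by blast
  \<comment> \<open>A real \<open>l\<close> exists even if the derivative is infinite.\<close>
  obtain l where l: "k < l" "ereal l < right_deriv_at_0 f"
    using ereal_dense2[OF deriv] by auto
  have "\<forall>\<^sub>F y in at_right 0. ereal l < ereal ((f y - f 0) / y)"
    using metric_preserving_right_deriv[OF f] l(2) by (rule order_tendstoD)
  then obtain \<delta> where "\<delta> > 0" and \<delta>: "\<And>y. 0 < y \<Longrightarrow> y < \<delta> \<Longrightarrow> l < f y / y"
    by (auto simp: eventually_at_right_field metric_preserving_0[OF f])
  have below: "l * y \<le> f y" if "0 \<le> y" "y < \<delta>" for y
    using that \<delta>[of y] metric_preserving_0[OF f] by (cases "y = 0") (auto simp: field_simps)
  \<comment> \<open>If \<open>\<delta> \<le> y\<close>, then \<open>\<delta> \<le> 2 * y\<close>, so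
    the isosceles bound gives \<open>f \<delta> \<le> 2 * f y\<close>.\<close>
  define m where "m = f \<delta> / 2"
  have "m > 0"
    using metric_preserving_pos[OF f \<open>\<delta> > 0\<close>] by (simp add: m_def)
  have above: "m \<le> f y" if "\<delta> \<le> y" for y
    using metric_preserving_double[OF f \<open>\<delta> > 0\<close>, of y] that \<open>\<delta> > 0\<close> by (simp add: m_def)
  have "\<exists>\<epsilon>>0. \<forall>u\<in>X. d x u < \<epsilon> \<longrightarrow> d (g x) (g u) \<le> k / l * d x u" if x: "x \<in> X" for x
  proof -
    obtain \<epsilon> where \<epsilon>: "\<epsilon> > 0" "\<And>u. u \<in> X \<Longrightarrow> d x u < \<epsilon> \<Longrightarrow> f (d (g x) (g u)) \<le> k * d x u"
      using contr[OF x] by blast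
    \<comment> \<open>The radius \<open>m / k\<close> makes \<open>k * d x u < m\<close>, which
      rules out \<open>\<delta> \<le> d (g x) (g u)\<close>, where \<open>f\<close> would be at
      least \<open>m\<close>.\<close>
    have "d (g x) (g u) \<le> k / l * d x u" if u: "u \<in> X" "d x u < min \<epsilon> (m / k)" for u
    proof -
      have fd: "f (d (g x) (g u)) \<le> k * d x u"
        using \<epsilon>(2) u by simp
      also have "\<dots> < m"
        using u k by (simp add: field_simps)
      finally have "d (g x) (g u) < \<delta>"
        using above by (meson not_le)
      then have "l * d (g x) (g u) \<le> k * d x u"
        using below fd by (meson nonneg order_trans)
      then show ?thesis
        using k l by (simp add: field_simps)
    qed
    then show ?thesis
      using \<epsilon>(1) \<open>m > 0\<close> k by (intro exI[of _ "min \<epsilon> (m / k)"]) auto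
  qed
  then show ?thesis
    unfolding local_radial_contraction_def using assms(2) k l(1)
    by (intro conjI exI[of _ "k / l"]) auto
qed

end
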